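(* Let $\underline{\mathbf X}\in\mathbb R^{I_1\times I_2\times\cdots\times I_N}$ admit the tensor train (TT) decomposition $$\underline{\mathbf X}=\underline{\mathbf G}^{(1)}\times^1\underline{\mathbf G}^{(2)}\times^1\cdots\times^1\underline{\mathbf G}^{(N)},$$ with TT-cores $\underline{\mathbf G}^{(n)}\in\mathbb R^{R_{n-1}\times I_n\times R_n}$, $n=1,\ldots,N$, $R_0=R_N=1$. Then: (a) $\displaystyle \mathrm{vec}(\underline{\mathbf X})=\left(\mathbf I_{I_1I_2\cdots I_{N-1}}\otimes\mathbf G^{(N)\top}_{(1)}\right)\left(\mathbf I_{I_1I_2\cdots I_{N-2}}\otimes\mathbf G^{(N-1)\top}_{(1)}\right)\cdots\left(\mathbf I_{I_1}\otimes\mathbf G^{(2)\top}_{(1)}\right)\mathbf G^{(1)\top}_{(1)}$; (b) $\displaystyle \mathrm{vec}(\underline{\mathbf X})=\left(\mathbf G^{(1)\top}_{(3)}\otimes\mathbf I_{I_2I_3\cdots I_N}\right)\left(\mathbf G^{(2)\top}_{(3)}\otimes\mathbf I_{I_3\cdots I_N}\right)\cdots\left(\mathbf G^{(N-1)\top}_{(3)}\otimes\mathbf I_{I_N}\right)\mathbf G^{(N)\top}_{(3)}$; (c) for every $n=1,\ldots,N$, $\displaystyle \mathrm{vec}(\underline{\mathbf X})=\left(\left(\mathbf G^{<n}_{(n)}\right)^\top\otimes\mathbf I_{I_n}\otimes\left(\mathbf G^{>n}_{(1)}\right)^\top\right)\mathrm{vec}\left(\underline{\mathbf G}^{(n)}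\right)$.
   Context: Tensors are real arrays. Multi-index: $\overline{i_1i_2\cdots i_N}=i_N+(i_{N-1}-1)I_N+\cdots+(i_1-1)I_2I_3\cdots I_N$ (last index fastest). For $\underline{\mathbf X}\in\mathbb R^{I_1\times\cdots\times I_N}$, the vectorization $\mathrm{vec}(\underline{\mathbf X})\in\mathbb R^{I_1\cdots I_N}$ and mode-$n$ matricization $\mathbf X_{(n)}\in\mathbb R^{I_n\times I_1\cdots I_{n-1}I_{n+1}\cdots I_N}$ are defined by $(\mathrm{vec}(\underline{\mathbf X}))_{\overline{i_1\cdots i_N}}=(\mathbf X_{(n)})_{i_n,\overline{i_1\cdots i_{n-1}i_{n+1}\cdots i_N}}=\underline{\mathbf X}(i_1,\ldots,i_N)$. $\mathbf G^{(n)}_{(k)}$ is the mode-$k$ matricization of the core $\underline{\mathbf G}^{(n)}$, so $\mathbf G^{(n)}_{(1)}\in\mathbb R^{R_{n-1}\times I_nR_n}$ and $\mathbf G^{(n)}_{(3)}\in\mathbb R^{R_n\times R_{n-1}I_n}$, and $\mathbf G^{(n)\top}_{(k)}$ is its transpose. $\mathbf I_k$ is the identity matrix, $\otimes$ the usual Kronecker product. Contracted product: for $\underline{\mathbf A}\in\mathbb R^{I_1\times\cdots\times I_M}$, $\underline{\mathbf B}\in\mathbb R^{J_1\times\cdots\times J_N}$ with $I_M=J_1$, $\underline{\mathbf A}\times^1\underline{\mathbf B}\in\mathbb R^{I_1\times\cdots\times I_{M-1}\times J_2\times\cdots\times J_N}$ has entries $\sum_{i_M}\underline{\mathbf A}(i_1,\ldots,i_M)\underline{\mathbf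 B}(i_M,j_2,\ldots,j_N)$. Singleton modes of size $R_0=1$ and $R_N=1$ at the ends of a contracted product are dropped, so the TT decomposition means $\underline{\mathbf X}(i_1,\ldots,i_N)=\underline{\mathbf G}^{(1)}(:,i_1,:)\,\underline{\mathbf G}^{(2)}(:,i_2,:)\cdots\underline{\mathbf G}^{(N)}(:,i_N,:)$ (a product of matrices of sizes $R_{n-1}\times R_n$). Partial products: $\underline{\mathbf G}^{<n}=\underline{\mathbf G}^{(1)}\times^1\cdots\times^1\underline{\mathbf G}^{(n-1)}\in\mathbb R^{I_1\times\cdots\times I_{n-1}\times R_{n-1}}$ and $\underline{\mathbf G}^{>n}=\underline{\mathbf G}^{(n+1)}\times^1\cdots\times^1\underline{\mathbf G}^{(N)}\in\mathbb R^{R_n\times I_{n+1}\times\cdots\times I_N}$, with $\underline{\mathbf G}^{<1}=\underline{\mathbf G}^{>N}=1$. Then $\mathbf G^{<n}_{(n)}\in\mathbb R^{R_{n-1}\times I_1\cdots I_{n-1}}$ is the mode-$n$ (last mode) matricization of $\underline{\mathbf G}^{<n}$ and $\mathbf G^{>n}_{(1)}\in\mathbb R^{R_n\times I_{n+1}\cdots I_N}$ is the mode-$1$ matricization of $\underline{\mathbf G}^{>n}$ (both equal to $1$ in the trivial cases). *)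

theory Defs
  imports Complex_Main "HOL-Library.FuncSet" "Jordan_Normal_Form.Matrix"
begin

text \<open>All entry indices are 0-based, as for the matrices and vectors of the library, whereas the
  modes of a tensor and the cores of a tensor train are numbered from 1.\<close>

section \<open>Multi-indices\<close>

definition multi_indices :: "nat list \<Rightarrow> nat list set" where
  "multi_indices ds = {is. list_all2 (<) is ds}"

text \<open>With 1-based indices the position of \<open>(i\<^sub>1, \<dots>, i\<^sub>N)\<close> is
  \<open>i\<^sub>N + (i\<^sub>N\<^sub>-\<^sub>1 - 1) I\<^sub>N + \<dots> + (i\<^sub>1 - 1) I\<^sub>2 \<dots> I\<^sub>N\<close>; subtracting 1 from every index and from the
  position gives the following formula (last index fastest).\<close>

definition multi_index :: "nat list \<Rightarrow> nat list \<Rightarrow> nat" where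
  "multi_index ds is = (\<Sum>k<length ds. is ! k * prod_list (drop (Suc k) ds))"

definition omit_mode :: "nat \<Rightarrow> 'b list \<Rightarrow> 'b list" where
  "omit_mode n xs = take (n - 1) xs @ drop n xs"

lemma multi_index_Nil [simp]: "multi_index [] is = 0"
  by (simp add: multi_index_def)

lemma multi_index_Cons [simp]:
  "multi_index (d # ds) (i # is) = i * prod_list ds + multi_index ds is"
  unfolding multi_index_def by (simp add: sum.lessThan_Suc_shift del: sum.lessThan_Suc)

lemma multi_index_less:
  assumes "is \<in> multi_indices ds"
  shows "multi_index ds is < prod_list ds"
  using assms unfolding multi_indices_def mem_Collect_eq
proof (induction rule: list_all2_induct)
  case (Cons i "is" d ds)
  have "i * prod_list ds + multi_index ds is < Suc i * prod_list ds"
    using Cons by simp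
  also have "\<dots> \<le> d * prod_list ds"
    using Cons by (intro mult_le_mono1) simp
  finally show ?case by simp
qed simp

lemma inj_on_multi_index: "inj_on (multi_index ds) (multi_indices ds)"
proof (induction ds)
  case (Cons d ds)
  show ?case
  proof (rule inj_onI)
    fix xs ys assume "xs \<in> multi_indices (d # ds)" "ys \<in> multi_indices (d # ds)"
      and eq: "multi_index (d # ds) xs = multi_index (d # ds) ys"
    then obtain i "is" j js where xs: "xs = i # is" "is \<in> multi_indices ds"
      and ys: "ys = j # js" "js \<in> multi_indices ds"
      by (auto simp: multi_indices_def list_all2_Cons2)
    have less: "multi_index ds is < prod_list ds" "multi_index ds js < prod_list ds"
      using xs ys by (auto intro: multi_index_less)
    have "i * prod_list ds + multi_index ds is = j * prod_list ds + multi_index ds js"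
      using eq xs ys by simp
    then have "i = j \<and> multi_index ds is = multi_index ds js"
      using less
      by (metis add.commute div_mult_self1 div_less mod_less mod_mult_self1 mult.commute
          add_0_right gr_implies_not0)
    then show "xs = ys"
      using xs ys Cons.IH by (auto dest: inj_onD)
  qed
qed (auto simp: multi_indices_def)

section \<open>Tensors\<close>

typedef 'a tensor = "{(ds :: nat list, f :: nat list \<Rightarrow> 'a). f \<in> extensional (multi_indices ds)}"
  by (rule exI[of _ "([], \<lambda>_. undefined)"]) (simp add: extensional_def)

definition dims :: "'a tensor \<Rightarrow> nat list" where
  "dims X = fst (Rep_tensor X)"

definition entry :: "'a tensor \<Rightarrow> nat list \<Rightarrow> 'a" where
  "entry X = snd (Rep_tensor X)"

definition tensor :: "nat list \<Rightarrow> (nat list \<Rightarrow> 'a) \<Rightarrow> 'a tensor" where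
  "tensor ds f = Abs_tensor (ds, restrict f (multi_indices ds))"

lemma dims_tensor [simp]: "dims (tensor ds f) = ds"
  by (simp add: dims_def tensor_def Abs_tensor_inverse)

lemma entry_tensor [simp]: "is \<in> multi_indices ds \<Longrightarrow> entry (tensor ds f) is = f is"
  by (simp add: entry_def tensor_def Abs_tensor_inverse)

lemma tensor_eqI:
  assumes "dims X = dims Y"
    and "\<And>is. is \<in> multi_indices (dims X) \<Longrightarrow> entry X is = entry Y is"
  shows "X = Y"
proof -
  have "entry Z \<in> extensional (multi_indices (dims Z))" for Z :: "'a tensor"
    using Rep_tensor[of Z] by (auto simp: entry_def dims_def split: prod.splits)
  then have "entry X = entry Y"
    using assms by (metis extensionalityI)
  then show ?thesis
    using assms(1) by (simp add: entry_def dims_def prod_eq_iff flip: Rep_tensor_inject)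
qed

text \<open>The inverse of \<open>multi_index\<close> recovers the multi-index of a position; the lemmas
  \<open>vectorize_index\<close> and \<open>matricize_index\<close> below are the usual defining equations.\<close>

definition vectorize :: "'a tensor \<Rightarrow> 'a vec" where
  "vectorize X = vec (prod_list (dims X))
     (\<lambda>p. entry X (inv_into (multi_indices (dims X)) (multi_index (dims X)) p))"

definition matricize :: "nat \<Rightarrow> 'a tensor \<Rightarrow> 'a mat" where
  "matricize n X = (let ds = omit_mode n (dims X) in
     mat (dims X ! (n - 1)) (prod_list ds)
       (\<lambda>(r, c). let js = inv_into (multi_indices ds) (multi_index ds) c in
          entry X (take (n - 1) js @ r # drop (n - 1) js)))"

lemma vectorize_index:
  assumes "is \<in> multi_indices (dims X)"
  shows "vectorize X $ multi_index (dims X) is = entry X is"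
  using assms by (simp add: vectorize_def multi_index_less inv_into_f_f[OF inj_on_multi_index])

lemma matricize_index:
  assumes "is \<in> multi_indices (dims X)" "1 \<le> n" "n \<le> length (dims X)"
  shows "matricize n X $$ (is ! (n - 1), multi_index (omit_mode n (dims X)) (omit_mode n is))
           = entry X is"
proof -
  have len: "length is = length (dims X)" and lt: "is ! (n - 1) < dims X ! (n - 1)"
    using assms by (auto simp: multi_indices_def list_all2_conv_all_nth)
  have mem: "omit_mode n is \<in> multi_indices (omit_mode n (dims X))"
    using assms unfolding multi_indices_def omit_mode_def
    by (auto intro!: list_all2_appendI list_all2_takeI list_all2_dropI)
  have "take (n - 1) (omit_mode n is) @ is ! (n - 1) # drop (n - 1) (omit_mode n is) = is"
    using assms(2,3) len id_take_nth_drop[of "n - 1" "is"]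
    by (cases n) (simp_all add: omit_mode_def min_def)
  then show ?thesis
    using lt mem
    by (simp add: matricize_def Let_def multi_index_less inv_into_f_f[OF inj_on_multi_index])
qed

section \<open>Contracted products and tensor trains\<close>

text \<open>The intended use is \<open>last (dims A) = hd (dims B)\<close>.\<close>

definition contract :: "'a::semiring_0 tensor \<Rightarrow> 'a tensor \<Rightarrow> 'a tensor" (infixl \<open>\<times>\<^sup>1\<close> 70) where
  "A \<times>\<^sup>1 B = tensor (butlast (dims A) @ tl (dims B))
     (\<lambda>is. let m = length (dims A) - 1 in
        \<Sum>k<last (dims A). entry A (take m is @ [k]) * entry B (k # drop m is))"

text \<open>Removal of a first or last mode of size 1.\<close>

definition drop_first_mode :: "'a tensor \<Rightarrow> 'a tensor" where
  "drop_first_mode X = tensor (tl (dims X)) (\<lambda>is. entry X (0 # is))"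

definition drop_last_mode :: "'a tensor \<Rightarrow> 'a tensor" where
  "drop_last_mode X = tensor (butlast (dims X)) (\<lambda>is. entry X (is @ [0]))"

text \<open>\<open>G m \<times>\<^sup>1 \<dots> \<times>\<^sup>1 G n\<close> for \<open>m \<le> n\<close>, with both boundary modes kept.\<close>

definition tt_chain :: "(nat \<Rightarrow> 'a::semiring_0 tensor) \<Rightarrow> nat \<Rightarrow> nat \<Rightarrow> 'a tensor" where
  "tt_chain G m n = foldl (\<times>\<^sup>1) (G m) (map G [Suc m..<Suc n])"

text \<open>The partial products before and after core \<open>n\<close>. The empty products are the scalar 1,
  represented as a tensor of order one and size \<open>R 0 = 1\<close> or \<open>R N = 1\<close>.\<close>

definition tt_before :: "(nat \<Rightarrow> 'a::semiring_1 tensor) \<Rightarrow> nat \<Rightarrow> 'a tensor" where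
  "tt_before G n =
     (if n = 1 then tensor [1] (\<lambda>_. 1) else drop_first_mode (tt_chain G 1 (n - 1)))"

definition tt_after :: "(nat \<Rightarrow> 'a::semiring_1 tensor) \<Rightarrow> nat \<Rightarrow> nat \<Rightarrow> 'a tensor" where
  "tt_after G N n =
     (if n = N then tensor [1] (\<lambda>_. 1) else drop_last_mode (tt_chain G (n + 1) N))"

section \<open>Matrices\<close>

definition kronecker :: "'a::times mat \<Rightarrow> 'a mat \<Rightarrow> 'a mat" (infixl \<open>\<otimes>\<^sub>K\<close> 75) where
  "A \<otimes>\<^sub>K B = mat (dim_row A * dim_row B) (dim_col A * dim_col B)
     (\<lambda>(i, j). A $$ (i div dim_row B, j div dim_col B) * B $$ (i mod dim_row B, j mod dim_col B))"

definition column_mat :: "'a vec \<Rightarrow> 'a mat" where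
  "column_mat v = mat_of_cols (dim_vec v) [v]"

end

theory Submission
  imports Defs
begin

text \<open>Contraction acts linearly on vectorizations:
  \<open>vec (A \<times>\<^sup>1 B)\<close> equals \<open>(I \<otimes> B\<^sub>(\<^sub>1\<^sub>)\<^sup>T) vec A\<close> and also \<open>(A\<^sub>(\<^sub>l\<^sub>a\<^sub>s\<^sub>t\<^sub>)\<^sup>T \<otimes> I) vec B\<close>.
  Iterating the first identity from the left of the train gives (a), iterating the second from the
  right gives (b). For (c), \<open>X = G\<^sup><\<^sup>n \<times>\<^sup>1 G n \<times>\<^sup>1 G\<^sup>>\<^sup>n\<close>; applying both identities once leaves a
  product of two Kronecker products, which the mixed-product rule merges into one.\<close>

section \<open>Multi-indices\<close>

text \<open>The range is cut into \<open>m\<close> blocks of length \<open>n\<close>: the quotient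
  names the block, the remainder the place in it. This turns the single sum over a column index of a
  Kronecker product into a double sum over the column indices of its factors.\<close>

lemma sum_div_mod:
  fixes f :: "nat \<Rightarrow> nat \<Rightarrow> 'a::comm_monoid_add"
  shows "(\<Sum>l<m * n. f (l div n) (l mod n)) = (\<Sum>i<m. \<Sum>k<n. f i k)"
proof -
  have "(\<Sum>l = i * n..<i * n + n. f (l div n) (l mod n)) = (\<Sum>k<n. f i k)" for i
  proof -
    have "(\<Sum>l = i * n..<i * n + n. f (l div n) (l mod n))
        = (\<Sum>k = 0..<n. f ((k + i * n) div n) ((k + i * n) mod n))"
      using sum.shift_bounds_nat_ivl[of "\<lambda>l. f (l div n) (l mod n)" 0 "i * n" n]
      by (simp add: add.commute)
    also have "\<dots> = (\<Sum>k<n. f i k)"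
      by (intro sum.cong) auto
    finally show ?thesis .
  qed
  then show ?thesis
    using sum.nat_group[of "\<lambda>l. f (l div n) (l mod n)" n m] by simp
qed

lemma multi_indices_Nil [simp]: "multi_indices [] = {[]}"
  by (auto simp: multi_indices_def)

lemma Cons_in_multi_indices [simp]:
  "i # is \<in> multi_indices (d # ds) \<longleftrightarrow> i < d \<and> is \<in> multi_indices ds"
  by (simp add: multi_indices_def)

lemma length_multi_indices: "is \<in> multi_indices ds \<Longrightarrow> length is = length ds"
  by (auto simp: multi_indices_def dest: list_all2_lengthD)

lemma append_in_multi_indices [simp]:
  "length is = length ds \<Longrightarrow>
    is @ js \<in> multi_indices (ds @ es) \<longleftrightarrow> is \<in> multi_indices ds \<and> js \<in> multi_indices es"
  by (simp add: multi_indices_def list_all2_append)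

lemma multi_indices_ConsE:
  assumes "xs \<in> multi_indices (d # ds)"
  obtains i "is" where "xs = i # is" "i < d" "is \<in> multi_indices ds"
  using assms by (auto simp: multi_indices_def list_all2_Cons2)

lemma multi_indices_appendE:
  assumes "xs \<in> multi_indices (ds @ es)"
  obtains "is" js where "xs = is @ js" "is \<in> multi_indices ds" "js \<in> multi_indices es"
  using assms by (auto simp: multi_indices_def list_all2_append2)

text \<open>The resulting form, block number times block length plus offset, is exactly the index
  layout of \<open>kronecker\<close>; this is the link between tensors and Kronecker
  products.\<close>

lemma multi_index_append:
  "length is = length ds \<Longrightarrow>
    multi_index (ds @ es) (is @ js) = multi_index ds is * prod_list es + multi_index es js"
  by (induction "is" ds rule: list_induct2) (simp_all add: algebra_simps)

text \<open>Mixed-radix expansion: the leading digit is the quotient by the product of the remaining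
  sizes, and the remainder is expanded recursively.\<close>

lemma multi_index_surj:
  assumes "p < prod_list ds"
  obtains "is" where "is \<in> multi_indices ds" "multi_index ds is = p"
  using assms
proof (induction ds arbitrary: p thesis)
  case (Cons d ds)
  let ?P = "prod_list ds"
  have "0 < ?P"
    using Cons.prems(2) by (cases ?P) auto
  then have "p mod ?P < ?P"
    by simp
  from Cons.IH[OF _ this] obtain "is" where "is": "is \<in> multi_indices ds" "multi_index ds is = p mod ?P"
    by blast
  show ?case
    using "is" Cons.prems(2)
    by (intro Cons.prems(1)[of "p div ?P # is"]) (simp_all add: less_mult_imp_div_less)
qed simp

section \<open>Vectorization and matricization\<close>

lemma dim_vectorize [simp]: "dim_vec (vectorize X) = prod_list (dims X)"
  by (simp add: vectorize_def)

text \<open>Every position is the position of some multi-index, so vectors can be compared at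
  multi-indices and the inverse in \<open>vectorize\<close> never has to be computed.\<close>

lemma vectorize_eqI:
  assumes "dim_vec v = prod_list (dims X)"
    and "\<And>is. is \<in> multi_indices (dims X) \<Longrightarrow> v $ multi_index (dims X) is = entry X is"
  shows "vectorize X = v"
proof (rule eq_vecI)
  fix p assume "p < dim_vec v"
  then obtain "is" where "is \<in> multi_indices (dims X)" "multi_index (dims X) is = p"
    using assms(1) multi_index_surj by metis
  then show "vectorize X $ p = v $ p"
    using assms(2) vectorize_index by metis
qed (simp add: assms(1))

lemma dim_matricize:
  "dim_row (matricize n X) = dims X ! (n - 1)"
  "dim_col (matricize n X) = prod_list (omit_mode n (dims X))"
  by (simp_all add: matricize_def Let_def)

lemma dim_matricize_first:
  assumes "dims X = d # ds"
  shows "dim_row (matricize (Suc 0) X) = d" "dim_col (matricize (Suc 0) X) = prod_list ds"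
  by (simp_all add: dim_matricize assms omit_mode_def)

lemma dim_matricize_last:
  assumes "dims X = ds @ [d]" "n = Suc (length ds)"
  shows "dim_row (matricize n X) = d" "dim_col (matricize n X) = prod_list ds"
  by (simp_all add: dim_matricize assms omit_mode_def)

lemma matricize_first:
  assumes "dims X = d # ds" "k < d" "is \<in> multi_indices ds"
  shows "matricize 1 X $$ (k, multi_index ds is) = entry X (k # is)"
  using matricize_index[of "k # is" X 1] assms by (simp add: omit_mode_def)

lemma matricize_last:
  assumes "dims X = ds @ [d]" "n = Suc (length ds)" "k < d" "is \<in> multi_indices ds"
  shows "matricize n X $$ (k, multi_index ds is) = entry X (is @ [k])"
  using matricize_index[of "is @ [k]" X n] assms length_multi_indices[OF assms(4)]
  by (simp add: omit_mode_def nth_append)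

section \<open>One-column matrices and size-one boundary modes\<close>

lemma dim_column_mat [simp]:
  "dim_row (column_mat v) = dim_vec v" "dim_col (column_mat v) = 1"
  by (simp_all add: column_mat_def)

lemma column_mat_index [simp]: "i < dim_vec v \<Longrightarrow> column_mat v $$ (i, 0) = v $ i"
  by (simp add: column_mat_def mat_of_cols_index)

lemma col_column_mat [simp]: "col (column_mat v) 0 = v"
  by (rule eq_vecI) simp_all

lemma column_mat_mult_mat_vec: "column_mat (A *\<^sub>v v) = A * column_mat v"
  by (rule eq_matI) simp_all

text \<open>The matricization has a single row, and a leading index 0 adds nothing to a position.
  With \<open>R 0 = 1\<close> this is the start of the induction for (a).\<close>

lemma column_mat_vectorize_first:
  assumes "dims X = 1 # ds"
  shows "column_mat (vectorize X) = transpose_mat (matricize 1 X)"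
proof -
  have "vectorize X = row (matricize 1 X) 0"
  proof (rule vectorize_eqI)
    fix xs assume "xs \<in> multi_indices (dims X)"
    then obtain "is" where xs: "xs = 0 # is" "is \<in> multi_indices ds"
      using assms by (auto elim: multi_indices_ConsE)
    then show "row (matricize 1 X) 0 $ multi_index (dims X) xs = entry X xs"
      using matricize_first[of X 1 ds 0 "is"] assms multi_index_less[of "is" ds]
      by (simp add: dim_matricize_first)
  qed (simp add: assms dim_matricize_first)
  then show ?thesis
    by (intro eq_matI) (simp_all add: assms dim_matricize_first)
qed

text \<open>A trailing mode of size 1 multiplies positions by 1 and adds 0. With
  \<open>R N = 1\<close> and \<open>n = 3\<close> this is the start of the induction for
  (b).\<close>

lemma column_mat_vectorize_last:
  assumes "dims X = ds @ [1]" "n = Suc (length ds)"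
  shows "column_mat (vectorize X) = transpose_mat (matricize n X)"
proof -
  note dim = dim_matricize_last[OF assms]
  have "vectorize X = row (matricize n X) 0"
  proof (rule vectorize_eqI)
    fix xs assume "xs \<in> multi_indices (dims X)"
    then obtain "is" where xs: "xs = is @ [0]" "is \<in> multi_indices ds"
      using assms by (auto elim!: multi_indices_appendE multi_indices_ConsE)
    then show "row (matricize n X) 0 $ multi_index (dims X) xs = entry X xs"
      using matricize_last[OF assms, of 0 "is"] multi_index_less[of "is" ds]
      by (simp add: dim assms(1) multi_index_append length_multi_indices)
  qed (simp add: assms(1) dim)
  then show ?thesis
    by (intro eq_matI) (simp_all add: assms(1) dim)
qed

lemma vectorize_drop_first_mode:
  assumes "dims X = 1 # ds"
  shows "vectorize (drop_first_mode X) = vectorize X"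
proof (rule vectorize_eqI)
  fix "is" assume "is": "is \<in> multi_indices (dims (drop_first_mode X))"
  then show "vectorize X $ multi_index (dims (drop_first_mode X)) is
      = entry (drop_first_mode X) is"
    using assms vectorize_index[of "0 # is" X] by (simp add: drop_first_mode_def)
qed (simp add: assms drop_first_mode_def)

lemma vectorize_drop_last_mode:
  assumes "dims X = ds @ [1]"
  shows "vectorize (drop_last_mode X) = vectorize X"
proof (rule vectorize_eqI)
  fix "is" assume "is": "is \<in> multi_indices (dims (drop_last_mode X))"
  then show "vectorize X $ multi_index (dims (drop_last_mode X)) is
      = entry (drop_last_mode X) is"
    using assms vectorize_index[of "is @ [0]" X]
    by (simp add: drop_last_mode_def length_multi_indices multi_index_append)
qed (simp add: assms drop_last_mode_def)

section \<open>Kronecker products\<close>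

lemma dim_kronecker [simp]:
  "dim_row (A \<otimes>\<^sub>K B) = dim_row A * dim_row B"
  "dim_col (A \<otimes>\<^sub>K B) = dim_col A * dim_col B"
  by (simp_all add: kronecker_def)

lemma kronecker_index:
  assumes "i < dim_row A * dim_row B" "j < dim_col A * dim_col B"
  shows "(A \<otimes>\<^sub>K B) $$ (i, j) =
    A $$ (i div dim_row B, j div dim_col B) * B $$ (i mod dim_row B, j mod dim_col B)"
  using assms by (simp add: kronecker_def)

lemma mod_less_of_less_mult: "i < m * n \<Longrightarrow> i mod n < (n::nat)"
  by (cases n) simp_all

text \<open>Both sides multiply the same three entries. An index has three mixed-radix digits, and
  \<open>split\<close> says that they do not depend on whether the last digit or the first one is
  separated first.\<close>

lemma kronecker_assoc:
  fixes A B C :: "'a::semigroup_mult mat"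
  shows "A \<otimes>\<^sub>K B \<otimes>\<^sub>K C = A \<otimes>\<^sub>K (B \<otimes>\<^sub>K C)"
proof -
  have less: "i div c < a * b" "i mod (b * c) < b * c"
    if "i < a * (b * c)" for i a b c :: nat
    using that by (auto simp: less_mult_imp_div_less mult.assoc mod_less_of_less_mult)
  have split: "i div c div b = i div (b * c)" "i div c mod b = i mod (b * c) div c"
    "i mod c = i mod (b * c) mod c" if "i < a * (b * c)" for i a b c :: nat
  proof -
    have "0 < c"
      using that by (cases c) auto
    \<comment> \<open>The two lower digits together: dividing this number by \<open>c\<close> gives
      both remaining equations.\<close>
    have bc: "i mod (b * c) = c * (i div c mod b) + i mod c"
      using mod_mult2_eq[of i c b] by (simp add: mult.commute)
    show "i div c div b = i div (b * c)"
      using div_mult2_eq[of i c b] by (simp add: mult.commute)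
    show "i div c mod b = i mod (b * c) div c" "i mod c = i mod (b * c) mod c"
      unfolding bc using \<open>0 < c\<close> by simp_all
  qed
  show ?thesis
  proof (rule eq_matI)
    fix i j
    assume "i < dim_row (A \<otimes>\<^sub>K (B \<otimes>\<^sub>K C))" "j < dim_col (A \<otimes>\<^sub>K (B \<otimes>\<^sub>K C))"
    then have ij: "i < dim_row A * (dim_row B * dim_row C)" "j < dim_col A * (dim_col B * dim_col C)"
      by simp_all
    show "(A \<otimes>\<^sub>K B \<otimes>\<^sub>K C) $$ (i, j) = (A \<otimes>\<^sub>K (B \<otimes>\<^sub>K C)) $$ (i, j)"
      using ij less[OF ij(1)] less[OF ij(2)]
      by (simp add: kronecker_index mult.assoc flip: split[OF ij(1)] split[OF ij(2)])
  qed (simp_all add: mult.assoc)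
qed

lemma kronecker_one: "1\<^sub>m m \<otimes>\<^sub>K 1\<^sub>m n = (1\<^sub>m (m * n) :: 'a::semiring_1 mat)"
proof (rule eq_matI)
  fix i j assume "i < dim_row (1\<^sub>m (m * n) :: 'a mat)" "j < dim_col (1\<^sub>m (m * n) :: 'a mat)"
  then have ij: "i < m * n" "j < m * n"
    by simp_all
  moreover have "i = j \<longleftrightarrow> i div n = j div n \<and> i mod n = j mod n"
    by (metis div_mult_mod_eq)
  ultimately show "(1\<^sub>m m \<otimes>\<^sub>K 1\<^sub>m n) $$ (i, j) = (1\<^sub>m (m * n) :: 'a mat) $$ (i, j)"
    by (simp add: kronecker_index less_mult_imp_div_less mod_less_of_less_mult)
qed simp_all

text \<open>The mixed-product rule. The summation index splits into a pair, and commutativity of the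
  entries lets the double sum factor into a product of two sums.\<close>

lemma kronecker_mult:
  fixes A B C D :: "'a::comm_semiring_0 mat"
  assumes "dim_col A = dim_row C" "dim_col B = dim_row D"
  shows "(A \<otimes>\<^sub>K B) * (C \<otimes>\<^sub>K D) = (A * C) \<otimes>\<^sub>K (B * D)"
proof (rule eq_matI)
  fix i j
  assume "i < dim_row ((A * C) \<otimes>\<^sub>K (B * D))" "j < dim_col ((A * C) \<otimes>\<^sub>K (B * D))"
  then have ij: "i < dim_row A * dim_row B" "j < dim_col C * dim_col D"
    by simp_all
  let ?i1 = "i div dim_row B" and ?i2 = "i mod dim_row B"
    and ?j1 = "j div dim_col D" and ?j2 = "j mod dim_col D"
  have less: "?i1 < dim_row A" "?i2 < dim_row B" "?j1 < dim_col C" "?j2 < dim_col D"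
    using ij by (simp_all add: less_mult_imp_div_less mod_less_of_less_mult)
  have "((A \<otimes>\<^sub>K B) * (C \<otimes>\<^sub>K D)) $$ (i, j) =
      (\<Sum>l<dim_row C * dim_row D. (A \<otimes>\<^sub>K B) $$ (i, l) * (C \<otimes>\<^sub>K D) $$ (l, j))"
    using ij assms by (simp add: scalar_prod_def atLeast0LessThan)
  also have "\<dots> = (\<Sum>l<dim_row C * dim_row D.
      A $$ (?i1, l div dim_row D) * B $$ (?i2, l mod dim_row D)
        * (C $$ (l div dim_row D, ?j1) * D $$ (l mod dim_row D, ?j2)))"
    using ij assms by (intro sum.cong refl) (simp add: kronecker_index)
  also have "\<dots> = (\<Sum>k<dim_row C. \<Sum>l<dim_row D.
      A $$ (?i1, k) * B $$ (?i2, l) * (C $$ (k, ?j1) * D $$ (l, ?j2)))"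
    by (rule sum_div_mod)
  also have "\<dots> = (\<Sum>k<dim_row C. A $$ (?i1, k) * C $$ (k, ?j1))
      * (\<Sum>l<dim_row D. B $$ (?i2, l) * D $$ (l, ?j2))"
    by (simp add: sum_product mult_ac)
  also have "\<dots> = ((A * C) \<otimes>\<^sub>K (B * D)) $$ (i, j)"
    using ij less assms by (simp add: kronecker_index scalar_prod_def atLeast0LessThan)
  finally show "((A \<otimes>\<^sub>K B) * (C \<otimes>\<^sub>K D)) $$ (i, j) = ((A * C) \<otimes>\<^sub>K (B * D)) $$ (i, j)" .
qed simp_all

text \<open>The row is given in the split form produced by \<open>multi_index_append\<close>, so no
  quotients or remainders are left when the lemma is applied to vectorizations.\<close>

lemma kronecker_mult_vec_index:
  fixes A B :: "'a::semiring_0 mat"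
  assumes "a < dim_row A" "b < dim_row B" "dim_vec v = dim_col A * dim_col B"
  shows "((A \<otimes>\<^sub>K B) *\<^sub>v v) $ (a * dim_row B + b) =
    (\<Sum>i<dim_col A. \<Sum>k<dim_col B. A $$ (a, i) * B $$ (b, k) * v $ (i * dim_col B + k))"
proof -
  have less: "a * dim_row B + b < dim_row A * dim_row B"
  proof -
    have "a * dim_row B + b < Suc a * dim_row B"
      using assms(2) by simp
    also have "\<dots> \<le> dim_row A * dim_row B"
      using assms(1) by (intro mult_le_mono1) simp
    finally show ?thesis .
  qed
  have "((A \<otimes>\<^sub>K B) *\<^sub>v v) $ (a * dim_row B + b) =
      (\<Sum>l<dim_col A * dim_col B. (A \<otimes>\<^sub>K B) $$ (a * dim_row B + b, l) * v $ l)"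
    using less assms(3) by (simp add: scalar_prod_def atLeast0LessThan)
  \<comment> \<open>The index of \<open>v\<close> is also written through quotient and remainder, so
    that the summand depends on \<open>l\<close> only through them.\<close>
  also have "\<dots> = (\<Sum>l<dim_col A * dim_col B.
      A $$ (a, l div dim_col B) * B $$ (b, l mod dim_col B)
        * v $ (l div dim_col B * dim_col B + l mod dim_col B))"
    using less assms(2) by (intro sum.cong refl) (simp add: kronecker_index)
  also have "\<dots> = (\<Sum>i<dim_col A. \<Sum>k<dim_col B.
      A $$ (a, i) * B $$ (b, k) * v $ (i * dim_col B + k))"
    by (rule sum_div_mod)
  finally show ?thesis .
qed

section \<open>Contracted products\<close>

lemma dims_contract:
  "dims A = as @ [r] \<Longrightarrow> dims B = s # bs \<Longrightarrow> dims (A \<times>\<^sup>1 B) = as @ bs"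
  by (simp add: contract_def)

lemma entry_contract:
  assumes "dims A = as @ [r]" "dims B = s # bs" "is \<in> multi_indices as" "js \<in> multi_indices bs"
  shows "entry (A \<times>\<^sup>1 B) (is @ js) = (\<Sum>k<r. entry A (is @ [k]) * entry B (k # js))"
  using assms by (simp add: contract_def Let_def length_multi_indices)

text \<open>The two finite sums are interchanged. The shape of \<open>dims B\<close> keeps the mode
  shared with \<open>A\<close> distinct from the one shared with \<open>C\<close>, so the two
  contractions do not interfere.\<close>

lemma contract_assoc:
  assumes "dims A = as @ [r]" "dims B = r # bs @ [s]" "dims C = s # cs"
  shows "A \<times>\<^sup>1 B \<times>\<^sup>1 C = A \<times>\<^sup>1 (B \<times>\<^sup>1 C)"
proof (rule tensor_eqI)
  have AB: "dims (A \<times>\<^sup>1 B) = (as @ bs) @ [s]" and BC: "dims (B \<times>\<^sup>1 C) = r # bs @ cs"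
    using dims_contract[of A as r B r "bs @ [s]"] dims_contract[of B "r # bs" s C s cs] assms
    by simp_all
  have ABC: "dims (A \<times>\<^sup>1 B \<times>\<^sup>1 C) = as @ bs @ cs"
    using dims_contract[OF AB assms(3)] by simp
  show "dims (A \<times>\<^sup>1 B \<times>\<^sup>1 C) = dims (A \<times>\<^sup>1 (B \<times>\<^sup>1 C))"
    using dims_contract[OF assms(1) BC] ABC by simp
  fix xs assume "xs \<in> multi_indices (dims (A \<times>\<^sup>1 B \<times>\<^sup>1 C))"
  then obtain "is" js ks where xs: "xs = is @ js @ ks"
    and mem: "is \<in> multi_indices as" "js \<in> multi_indices bs" "ks \<in> multi_indices cs"
    by (auto simp: ABC elim!: multi_indices_appendE)
  note len = length_multi_indices[OF mem(1)] length_multi_indices[OF mem(2)]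
  have "entry (A \<times>\<^sup>1 B \<times>\<^sup>1 C) xs
      = (\<Sum>l<s. entry (A \<times>\<^sup>1 B) ((is @ js) @ [l]) * entry C (l # ks))"
    using entry_contract[OF AB assms(3), of "is @ js" ks] mem len by (simp add: xs)
  also have "\<dots> = (\<Sum>l<s. (\<Sum>k<r. entry A (is @ [k]) * entry B (k # js @ [l])) * entry C (l # ks))"
    using entry_contract[OF assms(1,2) mem(1)] mem len by (intro sum.cong refl) simp
  also have "\<dots> = (\<Sum>k<r. entry A (is @ [k]) * (\<Sum>l<s. entry B ((k # js) @ [l]) * entry C (l # ks)))"
    unfolding sum_distrib_left sum_distrib_right by (subst sum.swap) (simp add: mult.assoc)
  also have "\<dots> = (\<Sum>k<r. entry A (is @ [k]) * entry (B \<times>\<^sup>1 C) (k # js @ ks))"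
    using entry_contract[of B "r # bs" s C s cs "k # js" ks for k] assms mem
    by (intro sum.cong refl) simp
  also have "\<dots> = entry (A \<times>\<^sup>1 (B \<times>\<^sup>1 C)) xs"
    using entry_contract[OF assms(1) BC mem(1), of "js @ ks"] mem len by (simp add: xs)
  finally show "entry (A \<times>\<^sup>1 B \<times>\<^sup>1 C) xs = entry (A \<times>\<^sup>1 (B \<times>\<^sup>1 C)) xs" .
qed

section \<open>Contraction as a linear map on vectorizations\<close>

text \<open>The contracted index is the fastest one of \<open>A\<close>, so each multi-index of the
  other modes owns a block of \<open>r\<close> consecutive entries of \<open>vectorize A\<close>.
  The same matrix acts on every block, hence a block-diagonal matrix with the identity on the
  left.\<close>

lemma vectorize_contract_left:
  fixes A B :: "'a::comm_semiring_1 tensor"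
  assumes "dims A = as @ [r]" "dims B = r # bs"
  shows "vectorize (A \<times>\<^sup>1 B) =
    (1\<^sub>m (prod_list as) \<otimes>\<^sub>K transpose_mat (matricize 1 B)) *\<^sub>v vectorize A"
proof (rule vectorize_eqI)
  let ?M = "transpose_mat (matricize 1 B)"
  note AB = dims_contract[OF assms] and B = dim_matricize_first[OF assms(2)]
  show "dim_vec ((1\<^sub>m (prod_list as) \<otimes>\<^sub>K ?M) *\<^sub>v vectorize A) = prod_list (dims (A \<times>\<^sup>1 B))"
    by (simp add: AB B)
  fix xs assume "xs \<in> multi_indices (dims (A \<times>\<^sup>1 B))"
  then obtain "is" js where xs: "xs = is @ js"
    and mem: "is \<in> multi_indices as" "js \<in> multi_indices bs"
    by (auto simp: AB elim!: multi_indices_appendE)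
  note less = multi_index_less[OF mem(1)] multi_index_less[OF mem(2)]
  have A: "vectorize A $ (multi_index as is * r + k) = entry A (is @ [k])" if "k < r" for k
    using vectorize_index[of "is @ [k]" A] assms that mem(1)
    by (simp add: length_multi_indices multi_index_append)
  have "((1\<^sub>m (prod_list as) \<otimes>\<^sub>K ?M) *\<^sub>v vectorize A) $ multi_index (dims (A \<times>\<^sup>1 B)) xs
      = (\<Sum>i<prod_list as. \<Sum>k<r. (if multi_index as is = i then 1 else 0)
          * ?M $$ (multi_index bs js, k) * vectorize A $ (i * r + k))"
    using kronecker_mult_vec_index[of "multi_index as is" "1\<^sub>m (prod_list as)"
        "multi_index bs js" ?M "vectorize A"] less mem
    by (simp add: AB B xs multi_index_append length_multi_indices assms(1))
  \<comment> \<open>The entry of the identity does not depend on \<open>k\<close>; taken out of the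
    inner sum, it leaves just one term of the outer sum.\<close>
  also have "\<dots> = (\<Sum>i<prod_list as. if multi_index as is = i
      then \<Sum>k<r. ?M $$ (multi_index bs js, k) * vectorize A $ (i * r + k) else 0)"
    by (intro sum.cong refl) simp
  also have "\<dots> = (\<Sum>k<r. entry A (is @ [k]) * entry B (k # js))"
    using less matricize_first[OF assms(2) _ mem(2)]
    by (simp add: A B) (simp add: mult.commute)
  also have "\<dots> = entry (A \<times>\<^sup>1 B) xs"
    using entry_contract[OF assms mem] by (simp add: xs)
  finally show "((1\<^sub>m (prod_list as) \<otimes>\<^sub>K ?M) *\<^sub>v vectorize A) $ multi_index (dims (A \<times>\<^sup>1 B)) xs
      = entry (A \<times>\<^sup>1 B) xs" .
qed

text \<open>Now the contracted index is the slowest one of \<open>B\<close>: it selects a whole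
  block, while the offset within the block is kept. The identity therefore stands on the
  right.\<close>

lemma vectorize_contract_right:
  fixes A B :: "'a::comm_semiring_1 tensor"
  assumes "dims A = as @ [r]" "dims B = r # bs" "n = Suc (length as)"
  shows "vectorize (A \<times>\<^sup>1 B) =
    (transpose_mat (matricize n A) \<otimes>\<^sub>K 1\<^sub>m (prod_list bs)) *\<^sub>v vectorize B"
proof (rule vectorize_eqI)
  let ?M = "transpose_mat (matricize n A)"
  note AB = dims_contract[OF assms(1,2)] and A = dim_matricize_last[OF assms(1,3)]
  show "dim_vec ((?M \<otimes>\<^sub>K 1\<^sub>m (prod_list bs)) *\<^sub>v vectorize B) = prod_list (dims (A \<times>\<^sup>1 B))"
    by (simp add: AB A)
  fix xs assume "xs \<in> multi_indices (dims (A \<times>\<^sup>1 B))"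
  then obtain "is" js where xs: "xs = is @ js"
    and mem: "is \<in> multi_indices as" "js \<in> multi_indices bs"
    by (auto simp: AB elim!: multi_indices_appendE)
  note less = multi_index_less[OF mem(1)] multi_index_less[OF mem(2)]
  have B: "vectorize B $ (k * prod_list bs + multi_index bs js) = entry B (k # js)" if "k < r" for k
    using vectorize_index[of "k # js" B] assms that mem(2) by simp
  have "((?M \<otimes>\<^sub>K 1\<^sub>m (prod_list bs)) *\<^sub>v vectorize B) $ multi_index (dims (A \<times>\<^sup>1 B)) xs
      = (\<Sum>k<r. \<Sum>j<prod_list bs. ?M $$ (multi_index as is, k)
          * (if multi_index bs js = j then 1 else 0) * vectorize B $ (k * prod_list bs + j))"
    using kronecker_mult_vec_index[of "multi_index as is" ?M
        "multi_index bs js" "1\<^sub>m (prod_list bs)" "vectorize B"] less mem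
    by (simp add: AB A xs multi_index_append length_multi_indices assms(2))
  also have "\<dots> = (\<Sum>k<r. \<Sum>j<prod_list bs. if multi_index bs js = j
      then ?M $$ (multi_index as is, k) * vectorize B $ (k * prod_list bs + j) else 0)"
    by (intro sum.cong refl) simp
  also have "\<dots> = (\<Sum>k<r. entry A (is @ [k]) * entry B (k # js))"
    using less matricize_last[OF assms(1,3) _ mem(1)] by (simp add: A B)
  also have "\<dots> = entry (A \<times>\<^sup>1 B) xs"
    using entry_contract[OF assms(1,2) mem] by (simp add: xs)
  finally show "((?M \<otimes>\<^sub>K 1\<^sub>m (prod_list bs)) *\<^sub>v vectorize B) $ multi_index (dims (A \<times>\<^sup>1 B)) xs
      = entry (A \<times>\<^sup>1 B) xs" .
qed

lemma vectorize_contract_middle: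
  fixes A B C :: "'a::comm_semiring_1 tensor"
  assumes A: "dims A = as @ [r]" and B: "dims B = [r, d, s]" and C: "dims C = s # cs"
    and n: "n = Suc (length as)"
  shows "vectorize (A \<times>\<^sup>1 B \<times>\<^sup>1 C) =
    (transpose_mat (matricize n A) \<otimes>\<^sub>K 1\<^sub>m d \<otimes>\<^sub>K transpose_mat (matricize 1 C)) *\<^sub>v vectorize B"
proof -
  let ?A = "transpose_mat (matricize n A)" and ?C = "transpose_mat (matricize 1 C)"
  note dimA = dim_matricize_last[OF A n] and dimC = dim_matricize_first[OF C]
  have AB: "dims (A \<times>\<^sup>1 B) = (as @ [d]) @ [s]"
    using dims_contract[OF A B] by simp
  have "vectorize (A \<times>\<^sup>1 B \<times>\<^sup>1 C)
      = (1\<^sub>m (prod_list as * d) \<otimes>\<^sub>K ?C) *\<^sub>v ((?A \<otimes>\<^sub>K 1\<^sub>m (d * s)) *\<^sub>v vectorize B)"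
    using vectorize_contract_left[OF AB C] vectorize_contract_right[OF A B n] by simp
  also have "\<dots> = ((1\<^sub>m (prod_list as * d) \<otimes>\<^sub>K ?C) * (?A \<otimes>\<^sub>K 1\<^sub>m (d * s))) *\<^sub>v vectorize B"
    by (rule assoc_mult_mat_vec[symmetric, OF carrier_matI[OF refl refl] carrier_matI[OF _ refl]
          carrier_vecI]) (simp_all add: dimA dimC B)
  \<comment> \<open>The identity is split so that the factors have matching sizes:
    \<open>1\<^sub>m (prod_list as)\<close> meets \<open>?A\<close>, and
    \<open>1\<^sub>m d \<otimes>\<^sub>K ?C\<close> meets \<open>1\<^sub>m (d * s)\<close>.\<close>
  also have "(1\<^sub>m (prod_list as * d) \<otimes>\<^sub>K ?C) * (?A \<otimes>\<^sub>K 1\<^sub>m (d * s))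
      = (1\<^sub>m (prod_list as) \<otimes>\<^sub>K (1\<^sub>m d \<otimes>\<^sub>K ?C)) * (?A \<otimes>\<^sub>K 1\<^sub>m (d * s))"
    by (simp flip: kronecker_one kronecker_assoc)
  also have "\<dots> = (1\<^sub>m (prod_list as) * ?A) \<otimes>\<^sub>K ((1\<^sub>m d \<otimes>\<^sub>K ?C) * 1\<^sub>m (d * s))"
    by (rule kronecker_mult) (simp_all add: dimA dimC)
  also have "\<dots> = ?A \<otimes>\<^sub>K 1\<^sub>m d \<otimes>\<^sub>K ?C"
    by (simp add: dimA dimC kronecker_assoc)
  finally show ?thesis .
qed

section \<open>Size-one boundary modes and the scalar 1 under contraction\<close>

text \<open>Fixing the first index of \<open>A\<close> at 0 does not touch its last mode, the one
  summed over. The size \<open>Suc q\<close> makes 0 an admissible index.\<close>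

lemma drop_first_mode_contract:
  assumes "dims A = Suc q # as @ [r]" "dims B = s # bs"
  shows "drop_first_mode (A \<times>\<^sup>1 B) = drop_first_mode A \<times>\<^sup>1 B"
proof (rule tensor_eqI)
  have dA: "dims (drop_first_mode A) = as @ [r]"
    using assms by (simp add: drop_first_mode_def)
  have AB: "dims (A \<times>\<^sup>1 B) = Suc q # as @ bs"
    using dims_contract[of A "Suc q # as" r B s bs] assms by simp
  show "dims (drop_first_mode (A \<times>\<^sup>1 B)) = dims (drop_first_mode A \<times>\<^sup>1 B)"
    using dims_contract[OF dA assms(2)] AB by (simp add: drop_first_mode_def)
  fix xs assume xs: "xs \<in> multi_indices (dims (drop_first_mode (A \<times>\<^sup>1 B)))"
  then obtain "is" js where xs: "xs = is @ js"
    and mem: "is \<in> multi_indices as" "js \<in> multi_indices bs"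
    by (auto simp: AB drop_first_mode_def elim!: multi_indices_appendE)
  have "entry (drop_first_mode (A \<times>\<^sup>1 B)) xs = entry (A \<times>\<^sup>1 B) ((0 # is) @ js)"
    using mem by (simp add: drop_first_mode_def AB xs length_multi_indices)
  also have "\<dots> = (\<Sum>k<r. entry A ((0 # is) @ [k]) * entry B (k # js))"
    using mem assms by (intro entry_contract[where as = "Suc q # as" and s = s]) simp_all
  also have "\<dots> = entry (drop_first_mode A \<times>\<^sup>1 B) xs"
    using mem assms entry_contract[OF dA assms(2) mem]
    by (simp add: xs drop_first_mode_def length_multi_indices)
  finally show "entry (drop_first_mode (A \<times>\<^sup>1 B)) xs = entry (drop_first_mode A \<times>\<^sup>1 B) xs" .
qed

lemma drop_last_mode_contract:
  assumes "dims A = as @ [r]" "dims B = r # bs @ [Suc q]"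
  shows "drop_last_mode (A \<times>\<^sup>1 B) = A \<times>\<^sup>1 drop_last_mode B"
proof (rule tensor_eqI)
  have dB: "dims (drop_last_mode B) = r # bs"
    using assms by (simp add: drop_last_mode_def)
  have AB: "dims (A \<times>\<^sup>1 B) = as @ bs @ [Suc q]"
    using dims_contract[OF assms] .
  show "dims (drop_last_mode (A \<times>\<^sup>1 B)) = dims (A \<times>\<^sup>1 drop_last_mode B)"
    using dims_contract[OF assms(1) dB] AB by (simp add: drop_last_mode_def butlast_append)
  fix xs assume xs: "xs \<in> multi_indices (dims (drop_last_mode (A \<times>\<^sup>1 B)))"
  then obtain "is" js where xs: "xs = is @ js"
    and mem: "is \<in> multi_indices as" "js \<in> multi_indices bs"
    by (auto simp: AB drop_last_mode_def butlast_append elim!: multi_indices_appendE)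
  have "entry (drop_last_mode (A \<times>\<^sup>1 B)) xs = entry (A \<times>\<^sup>1 B) (is @ (js @ [0]))"
    using mem by (simp add: drop_last_mode_def AB xs length_multi_indices butlast_append)
  also have "\<dots> = (\<Sum>k<r. entry A (is @ [k]) * entry B (k # js @ [0]))"
    using mem by (intro entry_contract[OF assms]) (simp_all add: length_multi_indices)
  also have "\<dots> = entry (A \<times>\<^sup>1 drop_last_mode B) xs"
    using mem assms entry_contract[OF assms(1) dB mem]
    by (simp add: xs drop_last_mode_def length_multi_indices)
  finally show "entry (drop_last_mode (A \<times>\<^sup>1 B)) xs = entry (A \<times>\<^sup>1 drop_last_mode B) xs" .
qed

text \<open>The sum over a mode of size 1 has one term, with weight 1 and index 0. This makes the
  convention for \<open>tt_before G 1\<close> fit the general contraction formula;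
  \<open>contract_one_right\<close> does the same for \<open>tt_after G N N\<close>.\<close>

lemma contract_one_left:
  assumes "dims A = 1 # as"
  shows "tensor [1] (\<lambda>_. 1) \<times>\<^sup>1 A = drop_first_mode (A :: 'a::semiring_1 tensor)"
proof (rule tensor_eqI)
  let ?E = "tensor [1] (\<lambda>_. 1) :: 'a tensor"
  have EA: "dims (?E \<times>\<^sup>1 A) = as"
    using dims_contract[of ?E "[]" 1 A 1 as] assms by simp
  then show "dims (?E \<times>\<^sup>1 A) = dims (drop_first_mode A)"
    using assms by (simp add: drop_first_mode_def)
  fix "is" assume "is \<in> multi_indices (dims (?E \<times>\<^sup>1 A))"
  then show "entry (?E \<times>\<^sup>1 A) is = entry (drop_first_mode A) is"
    using entry_contract[of ?E "[]" 1 A 1 as "[]" "is"] assms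
    by (simp add: EA[simplified] drop_first_mode_def)
qed

lemma contract_one_right:
  assumes "dims A = as @ [1]"
  shows "A \<times>\<^sup>1 tensor [1] (\<lambda>_. 1) = drop_last_mode (A :: 'a::semiring_1 tensor)"
proof (rule tensor_eqI)
  let ?E = "tensor [1] (\<lambda>_. 1) :: 'a tensor"
  have AE: "dims (A \<times>\<^sup>1 ?E) = as"
    using dims_contract[of A as 1 ?E 1 "[]"] assms by simp
  then show "dims (A \<times>\<^sup>1 ?E) = dims (drop_last_mode A)"
    using assms by (simp add: drop_last_mode_def)
  fix "is" assume "is \<in> multi_indices (dims (A \<times>\<^sup>1 ?E))"
  then show "entry (A \<times>\<^sup>1 ?E) is = entry (drop_last_mode A) is"
    using entry_contract[of A as 1 ?E 1 "[]" "is" "[]"] assms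
    by (simp add: AE[simplified] drop_last_mode_def)
qed

section \<open>Tensor trains\<close>

lemma tt_chain_same [simp]: "tt_chain G m m = G m"
  by (simp add: tt_chain_def)

lemma tt_chain_Suc: "m \<le> n \<Longrightarrow> tt_chain G m (Suc n) = tt_chain G m n \<times>\<^sup>1 G (Suc n)"
  by (simp add: tt_chain_def)

text \<open>The hypotheses on the cores alone. The arguments use only addition and commutative
  multiplication of entries, hence a commutative semiring.\<close>

locale tensor_train =
  fixes G :: "nat \<Rightarrow> 'a::comm_semiring_1 tensor" and I R :: "nat \<Rightarrow> nat" and N :: nat
  assumes N_pos: "1 \<le> N"
    and dims_core: "\<And>n. 1 \<le> n \<Longrightarrow> n \<le> N \<Longrightarrow> dims (G n) = [R (n - 1), I n, R n]"
    and R_first: "R 0 = 1" and R_last: "R N = 1"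
begin

lemma dims_tt_chain:
  assumes "1 \<le> m" "m \<le> n" "n \<le> N"
  shows "dims (tt_chain G m n) = R (m - 1) # map I [m..<Suc n] @ [R n]"
  using assms(2,1,3)
proof (induction n rule: dec_induct)
  case base
  then show ?case by (simp add: dims_core)
next
  case (step n)
  then show ?case
    using dims_contract[of "tt_chain G m n" "R (m - 1) # map I [m..<Suc n]" "R n" "G (Suc n)" "R n"]
      dims_core[of "Suc n"]
    by (simp add: tt_chain_Suc)
qed

text \<open>\<open>tt_chain\<close> is bracketed to the left; associativity, applied once per core
  after \<open>k\<close>, regroups it. Statement (b) needs the split after the first core, (c) the
  split after core \<open>n\<close>.\<close>

lemma tt_chain_split:
  assumes "1 \<le> m" "m \<le> k" "k < n" "n \<le> N"
  shows "tt_chain G m n = tt_chain G m k \<times>\<^sup>1 tt_chain G (Suc k) n"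
proof -
  have "Suc k \<le> n"
    using assms by simp
  then show ?thesis
    using assms(4)
  proof (induction n rule: dec_induct)
    case base
    then show ?case using assms by (simp add: tt_chain_Suc)
  next
    case (step n)
    have "tt_chain G m k \<times>\<^sup>1 tt_chain G (Suc k) n \<times>\<^sup>1 G (Suc n)
        = tt_chain G m k \<times>\<^sup>1 (tt_chain G (Suc k) n \<times>\<^sup>1 G (Suc n))"
      by (rule contract_assoc[where as = "R (m - 1) # map I [m..<Suc k]"
            and bs = "map I [Suc k..<Suc n]"])
        (use step assms dims_core[of "Suc n"] in \<open>simp_all add: dims_tt_chain del: upt_Suc\<close>)
    then show ?case
      using step assms by (simp add: tt_chain_Suc)
  qed
qed

abbreviation train :: "'a tensor" where
  "train \<equiv> drop_last_mode (drop_first_mode (tt_chain G 1 N))"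

text \<open>Because of this, (a) and (b) can be proved for the chain with both boundary modes kept,
  where every core has order three.\<close>

lemma vectorize_train: "vectorize train = vectorize (tt_chain G 1 N)"
proof -
  have dims: "dims (tt_chain G 1 N) = 1 # map I [1..<Suc N] @ [1]"
    using dims_tt_chain[of 1 N] N_pos R_first R_last by simp
  then have "dims (drop_first_mode (tt_chain G 1 N)) = map I [1..<Suc N] @ [1]"
    by (simp add: drop_first_mode_def)
  from vectorize_drop_last_mode[OF this] vectorize_drop_first_mode[OF dims] show ?thesis
    by (rule trans)
qed

section \<open>The factorizations (a) and (b)\<close>

text \<open>Induction over prefixes of the train: each new core multiplies from the left. As
  \<open>foldr\<close> brackets to the right, the factors act successively and their product never
  has to be rebracketed.\<close>

lemma vectorize_tt_chain_left:
  assumes "1 \<le> n" "n \<le> N"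
  shows "column_mat (vectorize (tt_chain G 1 n)) =
    foldr (*) (map (\<lambda>k. 1\<^sub>m (\<Prod>j=1..k - 1. I j) \<otimes>\<^sub>K transpose_mat (matricize 1 (G k)))
        (rev [2..<n + 1]))
      (transpose_mat (matricize 1 (G 1)))"
  using assms
proof (induction n rule: dec_induct)
  case base
  then show ?case
    using column_mat_vectorize_first[of "G 1"] dims_core[of 1] by (simp add: R_first)
next
  case (step n)
  \<comment> \<open>The modes before the contracted one are \<open>R 0\<close> and
    \<open>I 1\<close> to \<open>I n\<close>; since \<open>R 0 = 1\<close>, the size of the identity
    is the product of the latter.\<close>
  have "vectorize (tt_chain G 1 (Suc n))
      = (1\<^sub>m (\<Prod>j=1..n. I j) \<otimes>\<^sub>K transpose_mat (matricize 1 (G (Suc n))))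
        *\<^sub>v vectorize (tt_chain G 1 n)"
    using vectorize_contract_left[of "tt_chain G 1 n" "R 0 # map I [1..<Suc n]" "R n"
        "G (Suc n)" "[I (Suc n), R (Suc n)]"] step dims_tt_chain[of 1 n] dims_core[of "Suc n"]
    by (simp add: tt_chain_Suc R_first prod.distinct_set_conv_list[symmetric]
        atLeastLessThanSuc_atLeastAtMost del: upt_Suc)
  \<comment> \<open>After reversal the new factor is the head of the list, that is, the leftmost
    one.\<close>
  moreover have "[2..<Suc n + 1] = [2..<n + 1] @ [Suc n]"
    using step by simp
  ultimately show ?case
    using step by (simp add: column_mat_mult_mat_vec del: upt_Suc)
qed

text \<open>Downward induction over suffixes of the train, starting from the last core alone. Each
  core put in front multiplies from the left, and \<open>R N = 1\<close> removes the boundary mode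
  from the size of the identity.\<close>

lemma vectorize_tt_chain_right:
  assumes "1 \<le> m" "m \<le> N"
  shows "column_mat (vectorize (tt_chain G m N)) =
    foldr (*) (map (\<lambda>k. transpose_mat (matricize 3 (G k)) \<otimes>\<^sub>K 1\<^sub>m (\<Prod>j=k + 1..N. I j)) [m..<N])
      (transpose_mat (matricize 3 (G N)))"
  using assms(2,1)
proof (induction m rule: inc_induct)
  case base
  then show ?case
    using column_mat_vectorize_last[of "G N" "[R (N - 1), I N]" 3] dims_core[of N]
    by (simp add: R_last)
next
  case (step m)
  have "tt_chain G m N = G m \<times>\<^sup>1 tt_chain G (Suc m) N"
    using tt_chain_split[of m m N] step by simp
  then have "vectorize (tt_chain G m N)
      = (transpose_mat (matricize 3 (G m)) \<otimes>\<^sub>K 1\<^sub>m (\<Prod>j=m + 1..N. I j))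
        *\<^sub>v vectorize (tt_chain G (Suc m) N)"
    using vectorize_contract_right[of "G m" "[R (m - 1), I m]" "R m" "tt_chain G (Suc m) N"
        "map I [Suc m..<Suc N] @ [R N]" 3] step dims_tt_chain[of "Suc m" N] dims_core[of m]
    by (simp add: R_last prod.distinct_set_conv_list[symmetric]
        atLeastLessThanSuc_atLeastAtMost del: upt_Suc)
  then show ?case
    using step by (simp add: column_mat_mult_mat_vec upt_conv_Cons)
qed

section \<open>Partial products around one core and statement (c)\<close>

text \<open>For \<open>n = 1\<close> the list of tensor modes is empty and \<open>R 0 = 1\<close>,
  so the same formula covers the scalar 1.\<close>

lemma dims_tt_before:
  assumes "1 \<le> n" "n \<le> N"
  shows "dims (tt_before G n) = map I [1..<n] @ [R (n - 1)]"
  using assms dims_tt_chain[of 1 "n - 1"]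
  by (auto simp: tt_before_def drop_first_mode_def R_first simp del: upt_Suc)

lemma dims_tt_after:
  assumes "1 \<le> n" "n \<le> N"
  shows "dims (tt_after G N n) = R n # map I [Suc n..<Suc N]"
  using assms dims_tt_chain[of "Suc n" N]
  by (auto simp: tt_after_def drop_last_mode_def R_last butlast_append simp del: upt_Suc)

lemma tt_before_contract:
  assumes "1 \<le> n" "n \<le> N"
  shows "tt_before G n \<times>\<^sup>1 G n = drop_first_mode (tt_chain G 1 n)"
proof (cases "n = 1")
  case True
  then show ?thesis
    using contract_one_left[of "G 1"] dims_core[of 1] assms by (simp add: tt_before_def R_first)
next
  case False
  then obtain m where m: "n = Suc m" "1 \<le> m"
    using assms by (cases n) auto
  then show ?thesis
    using drop_first_mode_contract[of "tt_chain G 1 m" 0 "map I [1..<Suc m]" "R m" "G n"]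
      dims_tt_chain[of 1 m] dims_core[of n] assms
    by (simp add: tt_before_def R_first tt_chain_Suc del: upt_Suc)
qed

text \<open>For \<open>n < N\<close> the chain is cut after core \<open>n\<close>, and each dropped
  mode is moved into the half that owns it. For \<open>n = N\<close> the right factor is the scalar
  1, and contracting with it is the dropping of the last mode.\<close>

lemma train_split:
  assumes "1 \<le> n" "n \<le> N"
  shows "train = tt_before G n \<times>\<^sup>1 G n \<times>\<^sup>1 tt_after G N n"
proof (cases "n = N")
  case True
  have dims: "dims (drop_first_mode (tt_chain G 1 N)) = map I [1..<Suc N] @ [1]"
    using dims_tt_chain[of 1 N] N_pos R_last by (simp add: drop_first_mode_def)
  show ?thesis
    using contract_one_right[OF dims] True assms by (simp add: tt_before_contract tt_after_def)
next
  case False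
  let ?L = "tt_chain G 1 n" and ?H = "tt_chain G (Suc n) N"
  have L: "dims ?L = Suc 0 # map I [1..<Suc n] @ [R n]"
    using dims_tt_chain[of 1 n] assms by (simp add: R_first)
  have H: "dims ?H = R n # map I [Suc n..<Suc N] @ [Suc 0]"
    using dims_tt_chain[of "Suc n" N] assms False by (simp add: R_last)
  have "train = drop_last_mode (drop_first_mode (?L \<times>\<^sup>1 ?H))"
    using tt_chain_split[of 1 n N] assms False by simp
  also have "\<dots> = drop_last_mode (drop_first_mode ?L \<times>\<^sup>1 ?H)"
    using drop_first_mode_contract[OF L H] by simp
  also have "\<dots> = drop_first_mode ?L \<times>\<^sup>1 drop_last_mode ?H"
    by (rule drop_last_mode_contract[where as = "map I [1..<Suc n]", OF _ H])
      (use L in \<open>simp_all add: drop_first_mode_def del: upt_Suc\<close>)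
  finally show ?thesis
    using assms False by (simp add: tt_before_contract tt_after_def)
qed

text \<open>\<open>tt_before G n\<close> has \<open>n - 1\<close> tensor modes followed by the rank
  mode, so its mode \<open>n\<close> is its last one, also for \<open>n = 1\<close>.\<close>

lemma vectorize_train_core:
  assumes "n \<in> {1..N}"
  shows "vectorize train =
    (transpose_mat (matricize n (tt_before G n)) \<otimes>\<^sub>K 1\<^sub>m (I n)
      \<otimes>\<^sub>K transpose_mat (matricize 1 (tt_after G N n))) *\<^sub>v vectorize (G n)"
proof -
  have n: "1 \<le> n" "n \<le> N"
    using assms by simp_all
  show ?thesis
    unfolding train_split[OF n]
    by (rule vectorize_contract_middle[OF dims_tt_before dims_core dims_tt_after]) (use n in simp_all)
qed

end

theorem proposition3p1:
  fixes X :: "real tensor" and G :: "nat \<Rightarrow> real tensor"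
    and I R :: "nat \<Rightarrow> nat" and N :: nat
  assumes "1 \<le> N"
    and "dims X = map I [1..<N + 1]"
    and "\<And>n. 1 \<le> n \<Longrightarrow> n \<le> N \<Longrightarrow> dims (G n) = [R (n - 1), I n, R n]"
    and "R 0 = 1" and "R N = 1"
    and "X = drop_last_mode (drop_first_mode (tt_chain G 1 N))"
  shows "(column_mat (vectorize X) =
           foldr (*)
             (map (\<lambda>k. 1\<^sub>m (\<Prod>j=1..k - 1. I j) \<otimes>\<^sub>K transpose_mat (matricize 1 (G k)))
               (rev [2..<N + 1]))
             (transpose_mat (matricize 1 (G 1)))) \<and>
         (column_mat (vectorize X) =
           foldr (*)
             (map (\<lambda>k. transpose_mat (matricize 3 (G k)) \<otimes>\<^sub>K 1\<^sub>m (\<Prod>j=k + 1..N. I j)) [1..<N])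
             (transpose_mat (matricize 3 (G N)))) \<and>
         (\<forall>n\<in>{1..N}. vectorize X =
           (transpose_mat (matricize n (tt_before G n)) \<otimes>\<^sub>K 1\<^sub>m (I n)
              \<otimes>\<^sub>K transpose_mat (matricize 1 (tt_after G N n))) *\<^sub>v vectorize (G n))"
proof -
  interpret tensor_train G I R N
    using assms(1,3-5) by unfold_locales
  \<comment> \<open>This transfers (a) and (b) from the chain to \<open>X\<close>; (c) is already
    stated for the train with its boundary modes dropped, which is \<open>X\<close> itself.\<close>
  have vec: "vectorize X = vectorize (tt_chain G 1 N)"
    unfolding assms(6) by (rule vectorize_train)
  show ?thesis
    by (intro conjI ballI vectorize_tt_chain_left[OF N_pos order_refl, folded vec]
        vectorize_tt_chain_right[OF order_refl N_pos, folded vec]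
        vectorize_train_core[folded assms(6)])
qed

end
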